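(* Let $D$ be the $2n\times2n$ central Active Flux matrix given by $$(D\mathbf u)_{i}=\frac{u_{i+1/2}-u_{i-1/2}}{\Delta x},\qquad (D\mathbf u)_{i+1/2}=\frac{u_{i-1/2}-3u_i+3u_{i+1}-u_{i+3/2}}{\Delta x}.$$ Then $D$ has a two-dimensional nullspace spanned by $\mathbf 1$ and $(1,-1,1,-1,\dots,1,-1)^T$. Therefore $D$ (the central version of the Active Flux method) is not nullspace consistent.
   Context: Uniform periodic grid with $n$ cells of size $\Delta x>0$. The unknowns are cell averages $u_i$ and interface point values $u_{i+1/2}$, with $u_{i+n}=u_i$, $u_{i+n+1/2}=u_{i+1/2}$ (cell indices modulo $n$), collected in $\mathbf u=(u_{-1/2},u_0,u_{1/2},u_1,\dots,u_{n-3/2},u_{n-1})^T\in\mathbb R^{2n}$. $(D\mathbf u)_i$ and $(D\mathbf u)_{i+1/2}$ denote the components of $D\mathbf u$ at the positions of $u_i$ and $u_{i+1/2}$. $\mathbf 1$ is the all-ones vector. A matrix $D$ approximating $\partial_x$ on a periodic domain is called nullspace consistent if its kernel consists exactly of the multiples of $\mathbf 1$ (matching the kernel of $\partial_x$, the constant functions). *)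

theory Defs
  imports "Jordan_Normal_Form.Matrix_Kernel"
begin

text \<open>
  A grid function is a vector of length \<open>2 * n\<close>, ordered
  \<open>(u\<^bsub>-1/2\<^esub>, u\<^bsub>0\<^esub>, u\<^bsub>1/2\<^esub>, u\<^bsub>1\<^esub>, \<dots>, u\<^bsub>n-3/2\<^esub>, u\<^bsub>n-1\<^esub>)\<close>:
  entry \<open>2 * i\<close> is the point value at \<open>i - 1/2\<close> and entry \<open>2 * i + 1\<close> is the average of cell \<open>i\<close>.
  The two accessors below take arbitrary integer positions and reduce them modulo \<open>n\<close>.
  A half-integer position is given by its integer part: \<open>point_value n u i\<close> is the value at
  \<open>i + 1/2\<close>.
\<close>

definition cell_average :: "nat \<Rightarrow> real vec \<Rightarrow> int \<Rightarrow> real" where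
  "cell_average n u i = u $ (2 * nat (i mod int n) + 1)"

definition point_value :: "nat \<Rightarrow> real vec \<Rightarrow> int \<Rightarrow> real" where
  "point_value n u i = u $ (2 * nat ((i + 1) mod int n))"

definition active_flux_op :: "nat \<Rightarrow> real \<Rightarrow> real vec \<Rightarrow> real vec" where
  "active_flux_op n \<Delta>x u = vec (2 * n) (\<lambda>k.
     if odd k then
       (let i = int (k div 2) in
         (point_value n u i - point_value n u (i - 1)) / \<Delta>x)
     else
       (let i = int (k div 2) - 1 in
         (point_value n u (i - 1) - 3 * cell_average n u i
           + 3 * cell_average n u (i + 1) - point_value n u (i + 1)) / \<Delta>x))"

text \<open>
  The matrix of this linear map with respect to the standard basis. Working with columns rather
  than with a list of entries covers small \<open>n\<close>, where stencil positions coincide modulo \<open>n\<close>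
  and their coefficients add up.
\<close>

definition active_flux_matrix :: "nat \<Rightarrow> real \<Rightarrow> real mat" where
  "active_flux_matrix n \<Delta>x =
     mat (2 * n) (2 * n) (\<lambda>(r, c). active_flux_op n \<Delta>x (unit_vec (2 * n) c) $ r)"

definition ones_vec :: "nat \<Rightarrow> real vec" where
  "ones_vec m = vec m (\<lambda>_. 1)"

definition alternating_vec :: "nat \<Rightarrow> real vec" where
  "alternating_vec m = vec m (\<lambda>k. if even k then 1 else - 1)"

definition nullspace_consistent :: "real mat \<Rightarrow> bool" where
  "nullspace_consistent A \<longleftrightarrow> mat_kernel A = {c \<cdot>\<^sub>v ones_vec (dim_col A) | c. True}"

lemma active_flux_matrix_carrier [simp]:
  "active_flux_matrix n \<Delta>x \<in> carrier_mat (2 * n) (2 * n)"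
  by (simp add: active_flux_matrix_def)

lemma active_flux_matrix_mult_vec:
  assumes "n \<ge> 1" and u: "u \<in> carrier_vec (2 * n)"
  shows "active_flux_matrix n \<Delta>x *\<^sub>v u = active_flux_op n \<Delta>x u"
proof (rule eq_vecI)
  define S where "S g = (\<Sum>c = 0..<2 * n. g (unit_vec (2 * n) c) * u $ c)" for g :: "real vec \<Rightarrow> real"
  have idx: "S (\<lambda>v. v $ j) = u $ j" if "j < 2 * n" for j
  proof -
    have "S (\<lambda>v. v $ j) = (\<Sum>c = 0..<2 * n. if c = j then u $ c else 0)"
      unfolding S_def using that by (intro sum.cong) (auto simp: unit_vec_def)
    also have "\<dots> = u $ j" using that by simp
    finally show ?thesis .
  qed
  have lt: "nat (i mod int n) < n" for i
    using assms(1) by (simp add: nat_less_iff)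
  have Sp: "S (\<lambda>v. point_value n v i) = point_value n u i" for i
    unfolding point_value_def using lt[of "i + 1"] by (intro idx) simp
  have Sc: "S (\<lambda>v. cell_average n v i) = cell_average n u i" for i
    unfolding cell_average_def using lt[of i] by (intro idx) simp
  have lin: "S (\<lambda>v. f v - g v) = S f - S g" "S (\<lambda>v. f v + g v) = S f + S g"
    "S (\<lambda>v. a * f v) = a * S f" "S (\<lambda>v. f v / a) = S f / a" for f g a
    by (simp_all add: S_def algebra_simps sum.distrib sum_subtractf sum_distrib_left
        sum_divide_distrib)
  fix r assume "r < dim_vec (active_flux_op n \<Delta>x u)"
  then have r: "r < 2 * n" by (simp add: active_flux_op_def)
  have "(active_flux_matrix n \<Delta>x *\<^sub>v u) $ r = S (\<lambda>v. active_flux_op n \<Delta>x v $ r)"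
    using r u by (simp add: active_flux_matrix_def scalar_prod_def S_def)
  also have "\<dots> = active_flux_op n \<Delta>x u $ r"
    using r by (cases "even r") (simp_all add: active_flux_op_def Let_def lin Sp Sc)
  finally show "(active_flux_matrix n \<Delta>x *\<^sub>v u) $ r = active_flux_op n \<Delta>x u $ r" .
qed (simp add: active_flux_matrix_def active_flux_op_def)

lemma cell_average_active_flux:
  assumes "n \<ge> 1" and "u \<in> carrier_vec (2 * n)"
  shows "cell_average n (active_flux_matrix n \<Delta>x *\<^sub>v u) i =
    (point_value n u i - point_value n u (i - 1)) / \<Delta>x"
proof -
  have "nat (i mod int n) < n" using assms(1) by (simp add: nat_less_iff)
  moreover have "int (nat (i mod int n)) = i mod int n" using assms(1) by simp
  ultimately show ?thesis
    unfolding active_flux_matrix_mult_vec[OF assms]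
    by (simp add: cell_average_def active_flux_op_def point_value_def Let_def mod_simps)
qed

lemma point_value_active_flux:
  assumes "n \<ge> 1" and "u \<in> carrier_vec (2 * n)"
  shows "point_value n (active_flux_matrix n \<Delta>x *\<^sub>v u) i =
    (point_value n u (i - 1) - 3 * cell_average n u i
      + 3 * cell_average n u (i + 1) - point_value n u (i + 1)) / \<Delta>x"
proof -
  have 1: "nat ((i + 1) mod int n) < n" using assms(1) by (simp add: nat_less_iff)
  have 2: "int (nat ((i + 1) mod int n)) = (i + 1) mod int n" using assms(1) by simp
  have 3: "((i + 1) mod int n - 1) mod int n = i mod int n"
    by (simp add: mod_simps)
  have 4: "((i + 1) mod int n - 1 + 1 + 1) mod int n = (i + 1 + 1) mod int n"
    by (simp add: mod_simps)
  show ?thesis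
    unfolding active_flux_matrix_mult_vec[OF assms]
    using 1 2 3 4 by (simp add: cell_average_def active_flux_op_def point_value_def Let_def mod_simps)
qed

end

theory Submission
  imports Defs
begin

text \<open>
  The operator annihilates a grid function exactly when its point values are constant and its cell
  averages are constant, the two constants being unrelated. The reason is that point values and
  cell averages decouple one after the other: the rows at the cells say that consecutive point
  values agree, so all of them are equal; in the rows at the interfaces the two point values then
  cancel, and what remains says that consecutive cell averages agree
  (\<open>mat_kernel_active_flux_iff\<close>). The two constants are free parameters, which makes the kernel
  two-dimensional. Since \<open>ones_vec\<close> and \<open>alternating_vec\<close> are the grid functions with constants
  \<open>(1, 1)\<close> and \<open>(1, -1)\<close>, and these pairs form a basis of the plane, they form a basis of the
  kernel. The alternating vector is a kernel element that is not constant, and this defeats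
  nullspace consistency.

  Constancy is derived from the periodic extension of the data to all integer positions, so the
  argument needs no case distinction at the boundary and is the same for every \<open>n \<ge> 1\<close>, even when
  the stencil wraps around onto itself.
\<close>

lemma index_even_point_value:
  assumes "k < n"
  shows "u $ (2 * k) = point_value n u (int k - 1)"
  using assms by (simp add: point_value_def)

lemma index_odd_cell_average:
  assumes "k < n"
  shows "u $ (2 * k + 1) = cell_average n u (int k)"
  using assms by (simp add: cell_average_def)

text \<open>
  Every vector entry is read by one of the two accessors, at a position in the range of
  \<open>index_even_point_value\<close> or \<open>index_odd_cell_average\<close>. This allows equality of vectors to be
  checked on the periodic data, where the stencils of the matrix are shift invariant.
\<close>

lemma grid_function_eqI:
  assumes u: "u \<in> carrier_vec (2 * n)" and v: "v \<in> carrier_vec (2 * n)"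
    and point: "\<And>i. point_value n u i = point_value n v i"
    and cell: "\<And>i. cell_average n u i = cell_average n v i"
  shows "u = v"
proof (rule eq_vecI)
  fix r assume "r < dim_vec v"
  then have r: "r < 2 * n" using v by simp
  show "u $ r = v $ r"
  proof (cases "even r")
    case True
    then obtain k where "r = 2 * k" by (elim evenE)
    with r show ?thesis by (simp add: index_even_point_value point)
  next
    case False
    then obtain k where k: "r = 2 * k + 1" by (elim oddE)
    with r have "k < n" by simp
    then show ?thesis unfolding k by (simp only: index_odd_cell_average cell)
  qed
qed (use u v in simp)

lemma point_value_comb:
  assumes "n \<ge> 1"
  shows "point_value n (a \<cdot>\<^sub>v ones_vec (2 * n) + b \<cdot>\<^sub>v alternating_vec (2 * n)) i = a + b"
proof -
  have "nat ((i + 1) mod int n) < n" using assms by (simp add: nat_less_iff)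
  then show ?thesis by (simp add: point_value_def ones_vec_def alternating_vec_def)
qed

lemma cell_average_comb:
  assumes "n \<ge> 1"
  shows "cell_average n (a \<cdot>\<^sub>v ones_vec (2 * n) + b \<cdot>\<^sub>v alternating_vec (2 * n)) i = a - b"
proof -
  have "nat (i mod int n) < n" using assms by (simp add: nat_less_iff)
  then show ?thesis by (simp add: cell_average_def ones_vec_def alternating_vec_def)
qed

lemma point_value_zero:
  assumes "n \<ge> 1"
  shows "point_value n (0\<^sub>v (2 * n)) i = 0"
  using assms by (simp add: point_value_def nat_less_iff)

lemma cell_average_zero:
  assumes "n \<ge> 1"
  shows "cell_average n (0\<^sub>v (2 * n)) i = 0"
proof -
  have "nat (i mod int n) < n" using assms by (simp add: nat_less_iff)
  then show ?thesis by (simp add: cell_average_def)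
qed

lemma shift_invariant_imp_constant:
  fixes f :: "int \<Rightarrow> 'a"
  assumes "\<And>i. f (i + 1) = f i"
  shows "f i = f 0"
proof (induction i rule: int_induct[where k = 0])
  case (step2 i)
  then show ?case using assms[of "i - 1"] by simp
qed (simp_all add: assms)

text \<open>
  The cell rows involve only point values and force them to be constant. Only after that do the
  interface rows become a condition on the cell averages alone, of the form
  \<open>3 * (cell_average n u (i + 1) - cell_average n u i) = 0\<close>.
\<close>

lemma mat_kernel_active_flux_iff:
  assumes n: "n \<ge> 1" and dx: "\<Delta>x \<noteq> 0" and u: "u \<in> carrier_vec (2 * n)"
  shows "u \<in> mat_kernel (active_flux_matrix n \<Delta>x) \<longleftrightarrow>
    (\<exists>p c. \<forall>i. point_value n u i = p \<and> cell_average n u i = c)"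
    (is "_ \<longleftrightarrow> ?const")
proof -
  let ?D = "active_flux_matrix n \<Delta>x"
  have D: "?D \<in> carrier_mat (2 * n) (2 * n)" by simp
  show ?thesis
  proof
    assume "u \<in> mat_kernel ?D"
    then have Du: "?D *\<^sub>v u = 0\<^sub>v (2 * n)" using mat_kernelD(2)[OF D] by blast
    have "point_value n u (i + 1) = point_value n u i" for i
      using cell_average_active_flux[OF n u, of \<Delta>x "i + 1"] dx
      by (simp add: Du cell_average_zero[OF n])
    then have p: "point_value n u i = point_value n u 0" for i
      by (rule shift_invariant_imp_constant[where f = "point_value n u"])
    have "cell_average n u (i + 1) = cell_average n u i" for i
      using point_value_active_flux[OF n u, of \<Delta>x i] dx p[of "i - 1"] p[of "i + 1"]
      by (simp add: Du point_value_zero[OF n])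
    then have "cell_average n u i = cell_average n u 0" for i
      by (rule shift_invariant_imp_constant[where f = "cell_average n u"])
    with p show ?const by blast
  next
    assume ?const
    then obtain p c where pc: "\<And>i. point_value n u i = p" "\<And>i. cell_average n u i = c" by blast
    have "?D *\<^sub>v u = 0\<^sub>v (2 * n)"
    proof (rule grid_function_eqI)
      show "?D *\<^sub>v u \<in> carrier_vec (2 * n)" using D u by (rule mult_mat_vec_carrier)
      show "point_value n (?D *\<^sub>v u) i = point_value n (0\<^sub>v (2 * n)) i" for i
        by (simp add: point_value_active_flux[OF n u] point_value_zero[OF n] pc)
      show "cell_average n (?D *\<^sub>v u) i = cell_average n (0\<^sub>v (2 * n)) i" for i
        by (simp add: cell_average_active_flux[OF n u] cell_average_zero[OF n] pc)
    qed simp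
    with D u show "u \<in> mat_kernel ?D" by (intro mat_kernelI)
  qed
qed

lemma mat_kernel_active_flux:
  assumes n: "n \<ge> 1" and dx: "\<Delta>x \<noteq> 0"
  shows "mat_kernel (active_flux_matrix n \<Delta>x) =
    {a \<cdot>\<^sub>v ones_vec (2 * n) + b \<cdot>\<^sub>v alternating_vec (2 * n) | a b. True}"
    (is "mat_kernel ?D = ?R")
proof
  have comb: "a \<cdot>\<^sub>v ones_vec (2 * n) + b \<cdot>\<^sub>v alternating_vec (2 * n) \<in> carrier_vec (2 * n)" for a b
    by (simp add: ones_vec_def alternating_vec_def)
  show "mat_kernel ?D \<subseteq> ?R"
  proof
    fix u assume ker: "u \<in> mat_kernel ?D"
    have u: "u \<in> carrier_vec (2 * n)"
      using mat_kernelD(1)[OF active_flux_matrix_carrier ker] .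
    obtain p c where pc: "\<And>i. point_value n u i = p" "\<And>i. cell_average n u i = c"
      using ker mat_kernel_active_flux_iff[OF n dx u] by blast
    \<comment> \<open>The coefficients solve \<open>a + b = p\<close> and \<open>a - b = c\<close>.\<close>
    have "u = ((p + c) / 2) \<cdot>\<^sub>v ones_vec (2 * n) + ((p - c) / 2) \<cdot>\<^sub>v alternating_vec (2 * n)"
      by (rule grid_function_eqI[OF u comb];
          simp only: pc point_value_comb[OF n] cell_average_comb[OF n]; simp add: field_simps)
    then show "u \<in> ?R" by blast
  qed
  show "?R \<subseteq> mat_kernel ?D"
  proof
    fix u assume "u \<in> ?R"
    then obtain a b where "u = a \<cdot>\<^sub>v ones_vec (2 * n) + b \<cdot>\<^sub>v alternating_vec (2 * n)" by blast
    then have "u \<in> carrier_vec (2 * n)"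
      and "\<forall>i. point_value n u i = a + b \<and> cell_average n u i = a - b"
      by (simp_all only: comb point_value_comb[OF n] cell_average_comb[OF n] simp_thms)
    then show "u \<in> mat_kernel ?D"
      using mat_kernel_active_flux_iff[OF n dx] by blast
  qed
qed

context vec_space
begin

lemma lincomb_pair:
  assumes "v \<in> carrier_vec n" "w \<in> carrier_vec n" "v \<noteq> w"
  shows "lincomb f {v, w} = f v \<cdot>\<^sub>v v + f w \<cdot>\<^sub>v w"
  by (rule eq_vecI)
    (use assms in \<open>simp_all add: lincomb_index lincomb_dim\<close>)

lemma span_pair:
  assumes "v \<in> carrier_vec n" "w \<in> carrier_vec n" "v \<noteq> w"
  shows "span {v, w} = {a \<cdot>\<^sub>v v + b \<cdot>\<^sub>v w | a b. True}"
proof -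
  have "span {v, w} = range (\<lambda>f. lincomb f {v, w})"
    using assms by (subst finite_span) (auto simp: class_ring_simps)
  also have "\<dots> = {a \<cdot>\<^sub>v v + b \<cdot>\<^sub>v w | a b. True}"
  proof (intro equalityI subsetI)
    fix x assume "x \<in> {a \<cdot>\<^sub>v v + b \<cdot>\<^sub>v w | a b. True}"
    then obtain a b where x: "x = a \<cdot>\<^sub>v v + b \<cdot>\<^sub>v w" by blast
    have "x = lincomb (\<lambda>y. if y = v then a else b) {v, w}"
      using assms by (simp add: x lincomb_pair)
    then show "x \<in> range (\<lambda>f. lincomb f {v, w})" by blast
  qed (use assms in \<open>auto simp: lincomb_pair\<close>)
  finally show ?thesis .
qed

lemma lin_indpt_pairI:
  assumes "v \<in> carrier_vec n" "w \<in> carrier_vec n" "v \<noteq> w"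
    and "\<And>a b. a \<cdot>\<^sub>v v + b \<cdot>\<^sub>v w = 0\<^sub>v n \<Longrightarrow> a = 0 \<and> b = 0"
  shows "lin_indpt {v, w}"
proof -
  have "f x = 0" if "f v \<cdot>\<^sub>v v + f w \<cdot>\<^sub>v w = 0\<^sub>v n" "x \<in> {v, w}" for f x
    using assms(4)[OF that(1)] that(2) by auto
  then show ?thesis
    using assms(1-3) by (intro finite_lin_indpt2) (auto simp: lincomb_pair class_ring_simps)
qed

end

lemma kernel_dim_pair:
  fixes A :: "'a :: field mat"
  assumes A: "A \<in> carrier_mat nr nc"
    and v: "v \<in> carrier_vec nc" and w: "w \<in> carrier_vec nc" and "v \<noteq> w"
    and ker: "mat_kernel A = {a \<cdot>\<^sub>v v + b \<cdot>\<^sub>v w | a b. True}"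
    and indep: "\<And>a b. a \<cdot>\<^sub>v v + b \<cdot>\<^sub>v w = 0\<^sub>v nc \<Longrightarrow> a = 0 \<and> b = 0"
  shows "kernel_dim A = 2"
proof -
  interpret kernel nr nc A by unfold_locales (rule A)
  have "v = 1 \<cdot>\<^sub>v v + 0 \<cdot>\<^sub>v w" "w = 0 \<cdot>\<^sub>v v + 1 \<cdot>\<^sub>v w" using v w by auto
  then have sub: "{v, w} \<subseteq> mat_kernel A" unfolding ker by blast
  have "Ker.basis {v, w}"
    unfolding Ker.basis_def span_same[OF sub] lindep_same[OF sub]
    using sub NC.span_pair[OF v w \<open>v \<noteq> w\<close>] NC.lin_indpt_pairI[OF v w \<open>v \<noteq> w\<close> indep] ker by simp
  then have "Ker.dim = card {v, w}" by (intro Ker.dim_basis) simp_all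
  then show ?thesis using \<open>v \<noteq> w\<close> by simp
qed

theorem lemma6p2:
  fixes n :: nat and \<Delta>x :: real
  assumes "n \<ge> 1" and "\<Delta>x > 0"
  shows "kernel_dim (active_flux_matrix n \<Delta>x) = 2
    \<and> mat_kernel (active_flux_matrix n \<Delta>x) =
        LinearCombinations.module.span class_ring (module_vec TYPE(real) (2 * n))
          {ones_vec (2 * n), alternating_vec (2 * n)}
    \<and> \<not> nullspace_consistent (active_flux_matrix n \<Delta>x)"
proof -
  let ?D = "active_flux_matrix n \<Delta>x"
  let ?o = "ones_vec (2 * n)" and ?a = "alternating_vec (2 * n)"
  have o: "?o \<in> carrier_vec (2 * n)" and a: "?a \<in> carrier_vec (2 * n)"
    by (simp_all add: ones_vec_def alternating_vec_def)
  have ker: "mat_kernel ?D = {x \<cdot>\<^sub>v ?o + y \<cdot>\<^sub>v ?a | x y. True}"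
    using mat_kernel_active_flux[of n \<Delta>x] assms by simp
  have indep: "x = 0 \<and> y = 0" if "x \<cdot>\<^sub>v ?o + y \<cdot>\<^sub>v ?a = 0\<^sub>v (2 * n)" for x y
    using point_value_comb[OF assms(1), of x y 0] cell_average_comb[OF assms(1), of x y 0]
    by (simp add: that point_value_zero[OF assms(1)] cell_average_zero[OF assms(1)])
  have not_multiple: "?a \<noteq> c \<cdot>\<^sub>v ?o" for c
  proof
    assume "?a = c \<cdot>\<^sub>v ?o"
    then have "c \<cdot>\<^sub>v ?o + (- 1) \<cdot>\<^sub>v ?a = 0\<^sub>v (2 * n)" using o by auto
    then show False using indep by fastforce
  qed
  have ne: "?o \<noteq> ?a" using not_multiple[of 1] by auto
  have "kernel_dim ?D = 2"
    by (rule kernel_dim_pair[OF active_flux_matrix_carrier o a ne ker indep])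
  moreover have "mat_kernel ?D =
      LinearCombinations.module.span class_ring (module_vec TYPE(real) (2 * n)) {?o, ?a}"
    unfolding ker vec_space.span_pair[OF o a ne] ..
  moreover have "\<not> nullspace_consistent ?D"
  proof -
    have "?a = 0 \<cdot>\<^sub>v ?o + 1 \<cdot>\<^sub>v ?a" using o a by auto
    then have "?a \<in> mat_kernel ?D" unfolding ker by blast
    moreover have "dim_col ?D = 2 * n" by (simp add: active_flux_matrix_def)
    ultimately show ?thesis using not_multiple unfolding nullspace_consistent_def by auto
  qed
  ultimately show ?thesis by blast
qed

end
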